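(* Let $n\ge 2$ and $k\ge 1$, and let $\tilde H=SL_n(\mathbb{C})\times SL_n(\mathbb{C})$. Let $W$ be a finite-dimensional polynomial representation of $\tilde H^k$ with representation map $\rho$, extended polynomially to $(M_n(\mathbb{C})\times M_n(\mathbb{C}))^k$. Let $w\in P(W)$ be a generalized trace-like point and $h\in P(W)$ a generalized permanent (as defined in the context). Then for every $\sigma\in (M_n(\mathbb{C})\times M_n(\mathbb{C}))^k$, $w^\sigma\neq h$, where $w^\sigma$ is the point of $P(W)$ determined by $\rho(\sigma)\hat w$ ($\hat w$ a nonzero vector on the line $w$). More generally, the closure $\tilde\Delta_W[w]$ in $P(W)$ of the orbit $\tilde H^k\cdot w$ does not contain $h$.
   Context: Let $X$ be an $n\times n$ matrix of indeterminates; $\tilde H=SL_n(\mathbb{C})\times SL_n(\mathbb{C})$ acts on $n\times n$ matrices by $(A,B)\cdot X=AXB^{T}$ (i.e. naturally on $\mathbb{C}^n\otimes\mathbb{C}^n$), and hence on the space ${\rm Sym}^n(X)$ of degree-$n$ forms in the entries of $X$. Let $\tilde H_{\hat t}=\{(A,(A^{-1})^{T}):A\in SL_n(\mathbb{C})\}\subseteq\tilde H$ (the transformations $X\mapsto AXA^{-1}$, which stabilize $\hat t={\rm trace}(X^n)$), and let $\tilde H_{\hat h}\subseteq\tilde H$ be the stabilizer of $\hat h={\rm perm}(X)\in{\rm Sym}^n(X)$. For $w\in P(W)$ let $\hat w\in W$ be any nonzero vector on the corresponding line, and let $\tilde H^k_{\hat w}$ be its stabilizer in $\tilde H^k$. The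 point $w$ is called generalized trace-like if $(\tilde H_{\hat t})^k\subseteq\tilde H^k_{\hat w}$, i.e. $\hat w$ is invariant under $(\tilde H_{\hat t})^k=\tilde H_{\hat t}\times\cdots\times\tilde H_{\hat t}$. A point $h\in P(W)$ is called a generalized permanent if $\tilde H^k_{\hat h}=(\tilde H_{\hat h})^k$ for a nonzero vector $\hat h$ on the line $h$. *)

theory Defs
  imports "HOL-Analysis.Analysis"
begin

inductive polynomial_fun :: "('a \<Rightarrow> complex) set \<Rightarrow> ('a \<Rightarrow> complex) \<Rightarrow> bool"
  for C :: "('a \<Rightarrow> complex) set" where
  coord: "f \<in> C \<Longrightarrow> polynomial_fun C f"
| const: "polynomial_fun C (\<lambda>_. c)"
| add: "polynomial_fun C f \<Longrightarrow> polynomial_fun C g \<Longrightarrow> polynomial_fun C (\<lambda>x. f x + g x)"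
| mult: "polynomial_fun C f \<Longrightarrow> polynomial_fun C g \<Longrightarrow> polynomial_fun C (\<lambda>x. f x * g x)"

type_synonym 'n mat_pair = "(complex^'n^'n) \<times> (complex^'n^'n)"

text \<open>The monoid \<open>(M\<^sub>n \<times> M\<^sub>n)\<^sup>k\<close>, with \<open>n = CARD('n)\<close> and \<open>k = CARD('k)\<close>,
  is the type \<open>'k \<Rightarrow> 'n mat_pair\<close>; for \<open>S \<subseteq> M\<^sub>n \<times> M\<^sub>n\<close>
  the power \<open>S\<^sup>k\<close> is \<open>UNIV \<rightarrow> S\<close>.\<close>

definition tuple_one :: "'k \<Rightarrow> 'n::finite mat_pair" where
  "tuple_one = (\<lambda>_. (mat 1, mat 1))"

definition tuple_mult ::
    "('k \<Rightarrow> 'n::finite mat_pair) \<Rightarrow> ('k \<Rightarrow> 'n mat_pair) \<Rightarrow> ('k \<Rightarrow> 'n mat_pair)" where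
  "tuple_mult \<sigma> \<tau> = (\<lambda>i. (fst (\<sigma> i) ** fst (\<tau> i), snd (\<sigma> i) ** snd (\<tau> i)))"

definition tuple_entries :: "(('k \<Rightarrow> 'n::finite mat_pair) \<Rightarrow> complex) set" where
  "tuple_entries =
     {f. \<exists>l i j. f = (\<lambda>\<sigma>. fst (\<sigma> l) $ i $ j) \<or> f = (\<lambda>\<sigma>. snd (\<sigma> l) $ i $ j)}"

definition SL_pair :: "'n::finite mat_pair set" where
  "SL_pair = {(A, B). det A = 1 \<and> det B = 1}"

definition trace_stab :: "'n::finite mat_pair set" where
  "trace_stab = {(A, transpose (matrix_inv A)) | A. det A = 1}"

definition perm :: "complex^'n^'n \<Rightarrow> complex" where
  "perm X = (\<Sum>p | p permutes (UNIV :: 'n set). \<Prod>i\<in>UNIV. X $ i $ p i)"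

text \<open>Forms in the entries of \<open>X\<close> are identified with the functions they define on matrices.
  Whether a group element acts on forms by the substitution below or by its inverse makes no
  difference to the stabilizer.\<close>

definition perm_stab :: "'n::finite mat_pair set" where
  "perm_stab = {(A, B) \<in> SL_pair. (\<lambda>X. perm (A ** X ** transpose B)) = perm}"

text \<open>Polynomial representation on \<open>W\<close> (scalar multiplication \<open>s\<close>) of a
  submonoid \<open>S\<close> of \<open>(M\<^sub>n \<times> M\<^sub>n)\<^sup>k\<close>: every matrix coefficient is the restriction
  to \<open>S\<close> of a polynomial in the matrix entries. The values of \<open>\<rho>\<close> outside \<open>S\<close> are irrelevant.\<close>

definition polynomial_rep ::
    "(complex \<Rightarrow> 'w::ab_group_add \<Rightarrow> 'w) \<Rightarrow> ('k \<Rightarrow> 'n::finite mat_pair) set \<Rightarrow>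
     (('k \<Rightarrow> 'n mat_pair) \<Rightarrow> 'w \<Rightarrow> 'w) \<Rightarrow> bool" where
  "polynomial_rep s S \<rho> \<longleftrightarrow>
     (\<forall>g\<in>S. Vector_Spaces.linear s s (\<rho> g)) \<and>
     \<rho> tuple_one = id \<and>
     (\<forall>g\<in>S. \<forall>h\<in>S. \<rho> (tuple_mult g h) = \<rho> g \<circ> \<rho> h) \<and>
     (\<forall>\<phi> v. Vector_Spaces.linear s (*) \<phi> \<longrightarrow>
        (\<exists>p. polynomial_fun tuple_entries p \<and> (\<forall>g\<in>S. \<phi> (\<rho> g v) = p g)))"

text \<open>The extension of a representation of \<open>(SL\<^sub>n \<times> SL\<^sub>n)\<^sup>k\<close> is again multiplicative. Mere
  polynomiality would not do: since \<open>det = 1\<close> on \<open>SL\<^sub>n\<close>, one could add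
  \<open>(det A - 1) T\<close> with an arbitrary endomorphism \<open>T\<close>.\<close>

definition polynomial_extension ::
    "(complex \<Rightarrow> 'w::ab_group_add \<Rightarrow> 'w) \<Rightarrow> (('k \<Rightarrow> 'n::finite mat_pair) \<Rightarrow> 'w \<Rightarrow> 'w) \<Rightarrow>
     (('k \<Rightarrow> 'n mat_pair) \<Rightarrow> 'w \<Rightarrow> 'w) \<Rightarrow> bool" where
  "polynomial_extension s \<rho> \<rho>M \<longleftrightarrow>
     polynomial_rep s UNIV \<rho>M \<and> (\<forall>g \<in> UNIV \<rightarrow> SL_pair. \<rho>M g = \<rho> g)"

definition line :: "(complex \<Rightarrow> 'w \<Rightarrow> 'w) \<Rightarrow> 'w \<Rightarrow> 'w set" where
  "line s v = range (\<lambda>c. s c v)"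

definition proj_space :: "(complex \<Rightarrow> 'w::zero \<Rightarrow> 'w) \<Rightarrow> 'w set set" where
  "proj_space s = {line s v | v. v \<noteq> 0}"

definition homogeneous_form ::
    "(complex \<Rightarrow> 'w::ab_group_add \<Rightarrow> 'w) \<Rightarrow> ('w \<Rightarrow> complex) \<Rightarrow> bool" where
  "homogeneous_form s f \<longleftrightarrow>
     polynomial_fun {\<phi>. Vector_Spaces.linear s (*) \<phi>} f \<and> (\<exists>d. \<forall>c v. f (s c v) = c ^ d * f v)"

definition proj_closed ::
    "(complex \<Rightarrow> 'w::ab_group_add \<Rightarrow> 'w) \<Rightarrow> 'w set set \<Rightarrow> bool" where
  "proj_closed s Z \<longleftrightarrow>
     (\<exists>F. (\<forall>f\<in>F. homogeneous_form s f) \<and> Z = {L \<in> proj_space s. \<forall>f\<in>F. \<forall>v\<in>L. f v = 0})"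

text \<open>Zariski closure. For an orbit of an algebraic group it coincides with the closure in the
  Euclidean topology; in general it contains the latter.\<close>

definition proj_closure ::
    "(complex \<Rightarrow> 'w::ab_group_add \<Rightarrow> 'w) \<Rightarrow> 'w set set \<Rightarrow> 'w set set" where
  "proj_closure s Y = \<Inter>{Z. proj_closed s Z \<and> Y \<subseteq> Z}"

definition orbit ::
    "(complex \<Rightarrow> 'w::zero \<Rightarrow> 'w) \<Rightarrow> (('k \<Rightarrow> 'n::finite mat_pair) \<Rightarrow> 'w \<Rightarrow> 'w) \<Rightarrow>
     'w set \<Rightarrow> 'w set set" where
  "orbit s \<rho> w = {line s (\<rho> g v) | g v. g \<in> UNIV \<rightarrow> SL_pair \<and> v \<in> w - {0}}"

definition stabilizer ::
    "(('k \<Rightarrow> 'n::finite mat_pair) \<Rightarrow> 'w \<Rightarrow> 'w) \<Rightarrow> 'w \<Rightarrow> ('k \<Rightarrow> 'n mat_pair) set" where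
  "stabilizer \<rho> v = {g \<in> UNIV \<rightarrow> SL_pair. \<rho> g v = v}"

text \<open>By linearity of \<open>\<rho> g\<close>, neither of the following two conditions depends on the choice of
  the nonzero vector on the line.\<close>

definition generalized_trace_like ::
    "(complex \<Rightarrow> 'w::zero \<Rightarrow> 'w) \<Rightarrow> (('k \<Rightarrow> 'n::finite mat_pair) \<Rightarrow> 'w \<Rightarrow> 'w) \<Rightarrow>
     'w set \<Rightarrow> bool" where
  "generalized_trace_like s \<rho> w \<longleftrightarrow>
     w \<in> proj_space s \<and> (\<exists>v \<in> w - {0}. (UNIV \<rightarrow> trace_stab) \<subseteq> stabilizer \<rho> v)"

definition generalized_permanent ::
    "(complex \<Rightarrow> 'w::zero \<Rightarrow> 'w) \<Rightarrow> (('k \<Rightarrow> 'n::finite mat_pair) \<Rightarrow> 'w \<Rightarrow> 'w) \<Rightarrow>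
     'w set \<Rightarrow> bool" where
  "generalized_permanent s \<rho> h \<longleftrightarrow>
     h \<in> proj_space s \<and> (\<exists>v \<in> h - {0}. stabilizer \<rho> v = (UNIV \<rightarrow> perm_stab))"

end

theory Submission
  imports Defs "HOL-Computational_Algebra.Polynomial"
begin

text \<open>
  Fix one of the \<open>k\<close> places. A vector \<open>v\<close> with stabilizer \<open>perm_stab\<^sup>k\<close> is fixed by the diagonal
  torus but by no root subgroup of the \<open>SL\<^sub>n \<times> SL\<^sub>n\<close> at that place, so the \<open>2n(n - 1)\<close> root
  vectors of the Lie algebra send \<open>v\<close> to nonzero weight vectors of distinct weights, which are
  linearly independent. If \<open>v\<close> is invariant under all \<open>(A, A\<^bsup>-T\<^esup>)\<close>, then
  \<open>\<rho>(A, B) v\<close> depends essentially on \<open>A B\<^sup>T\<close> only, hence the root vectors move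
  \<open>\<rho>(A, B) v\<close> inside a space of dimension at most \<open>n\<^sup>2 - 1 < 2n(n - 1)\<close>. Linear dependence of
  the images of the root vectors is expressed by the vanishing of determinants, which are
  homogeneous forms on \<open>W\<close>; one of them separates \<open>h\<close> from the whole orbit. For singular
  \<open>\<sigma>\<close> its vanishing at \<open>\<rho>(\<sigma>) v\<close> follows by joining \<open>\<sigma>\<close> to the identity by a line.
\<close>

section \<open>Polynomial functions\<close>

lemma polynomial_fun_sum:
  assumes "finite I" "\<And>i. i \<in> I \<Longrightarrow> polynomial_fun C (f i)"
  shows "polynomial_fun C (\<lambda>x. \<Sum>i\<in>I. f i x)"
  using assms
  by (induction I rule: finite_induct) (auto intro: polynomial_fun.const polynomial_fun.add)

lemma polynomial_fun_prod:
  assumes "finite I" "\<And>i. i \<in> I \<Longrightarrow> polynomial_fun C (f i)"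
  shows "polynomial_fun C (\<lambda>x. \<Prod>i\<in>I. f i x)"
  using assms
  by (induction I rule: finite_induct) (auto intro: polynomial_fun.const polynomial_fun.mult)

lemma polynomial_fun_det:
  assumes "\<And>i j. polynomial_fun C (\<lambda>x. M x $ i $ j)"
  shows "polynomial_fun C (\<lambda>x. det (M x :: complex^'r::finite^'r))"
  unfolding det_def
  by (intro polynomial_fun_sum polynomial_fun.mult polynomial_fun.const polynomial_fun_prod assms)
     simp_all

text \<open>Along a polynomial curve everything becomes a polynomial in one variable, which is
  differentiable and vanishes identically as soon as it vanishes at infinitely many points.\<close>

lemma polynomial_fun_curve:
  assumes "polynomial_fun C q" and "\<And>f. f \<in> C \<Longrightarrow> \<exists>P. \<forall>x. f (c x) = poly P x"
  shows "\<exists>P. \<forall>x. q (c x) = poly P x"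
  using assms(1)
proof induction
  case (const a)
  have "\<forall>x. a = poly [:a:] x" by simp
  then show ?case by blast
next
  case (add f g)
  then show ?case by (metis poly_add)
next
  case (mult f g)
  then show ?case by (metis poly_mult)
qed (use assms(2) in blast)

text \<open>The gradient \<open>Q\<close> is chosen before the direction \<open>D\<close>, so a
  linear relation between directions carries over to the derivatives. Only the first matrix at place
  \<open>l\<close> moves.\<close>

lemma polynomial_fun_gradient:
  fixes q :: "('k \<Rightarrow> 'n::finite mat_pair) \<Rightarrow> complex"
  assumes "polynomial_fun tuple_entries q"
  shows "\<exists>Q. \<forall>D. ((\<lambda>x. q (\<sigma>(l := (\<chi> a b. A $ a $ b + x * D $ a $ b, B))))
           has_field_derivative (\<Sum>a\<in>UNIV. \<Sum>b\<in>UNIV. Q a b * D $ a $ b)) (at 0)"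
  using assms
proof induction
  case (coord f)
  then obtain m i j where f: "f = (\<lambda>\<sigma>. fst (\<sigma> m) $ i $ j) \<or> f = (\<lambda>\<sigma>. snd (\<sigma> m) $ i $ j)"
    by (auto simp: tuple_entries_def)
  show ?case
  \<comment> \<open>A coordinate varies along the line only if it reads the first matrix at place
    \<open>l\<close>; its gradient is then a matrix unit.\<close>
  proof (cases "f = (\<lambda>\<sigma>. fst (\<sigma> m) $ i $ j) \<and> m = l")
    case True
    have "(\<Sum>a\<in>UNIV. \<Sum>b\<in>UNIV. (if a = i \<and> b = j then 1 else 0) * D $ a $ b) = D $ i $ j"
      for D :: "complex^'n^'n"
    proof -
      have "(\<Sum>a\<in>UNIV. \<Sum>b\<in>UNIV. (if a = i \<and> b = j then 1 else 0) * D $ a $ b)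
          = (\<Sum>a\<in>UNIV. if a = i then D $ a $ j else 0)"
        by (rule sum.cong) (auto simp: if_distrib[of "\<lambda>t. t * _"] cong: if_cong)
      then show ?thesis by simp
    qed
    then show ?thesis using True
      by (intro exI[of _ "\<lambda>a b. if a = i \<and> b = j then 1 else 0"])
        (auto intro!: derivative_eq_intros)
  next
    case False
    then have "\<exists>c. \<forall>D x. f (\<sigma>(l := (\<chi> a b. A $ a $ b + x * D $ a $ b, B))) = c"
      using f by (cases "m = l") auto
    then show ?thesis by (intro exI[of _ "\<lambda>_ _. 0"]) (auto simp del: fun_upd_apply)
  qed
next
  case (const c)
  show ?case by (intro exI[of _ "\<lambda>_ _. 0"]) simp
next
  case (add f g)
  then obtain Q R where QR: "\<And>D. ((\<lambda>x. f (\<sigma>(l := (\<chi> a b. A $ a $ b + x * D $ a $ b, B))))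
           has_field_derivative (\<Sum>a\<in>UNIV. \<Sum>b\<in>UNIV. Q a b * D $ a $ b)) (at 0)"
      "\<And>D. ((\<lambda>x. g (\<sigma>(l := (\<chi> a b. A $ a $ b + x * D $ a $ b, B))))
           has_field_derivative (\<Sum>a\<in>UNIV. \<Sum>b\<in>UNIV. R a b * D $ a $ b)) (at 0)"
    by blast
  show ?case
    by (intro exI[of _ "\<lambda>a b. Q a b + R a b"] allI,
        rule derivative_eq_intros, rule QR, rule QR)
      (simp add: sum.distrib algebra_simps)
next
  case (mult f g)
  then obtain Q R where QR: "\<And>D. ((\<lambda>x. f (\<sigma>(l := (\<chi> a b. A $ a $ b + x * D $ a $ b, B))))
           has_field_derivative (\<Sum>a\<in>UNIV. \<Sum>b\<in>UNIV. Q a b * D $ a $ b)) (at 0)"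
      "\<And>D. ((\<lambda>x. g (\<sigma>(l := (\<chi> a b. A $ a $ b + x * D $ a $ b, B))))
           has_field_derivative (\<Sum>a\<in>UNIV. \<Sum>b\<in>UNIV. R a b * D $ a $ b)) (at 0)"
    by blast
  have A: "(\<chi> a b. A $ a $ b) = A" by (simp add: vec_eq_iff)
  let ?f = "f (\<sigma>(l := (A, B)))" and ?g = "g (\<sigma>(l := (A, B)))"
  show ?case
    by (intro exI[of _ "\<lambda>a b. ?f * R a b + Q a b * ?g"] allI,
        rule derivative_eq_intros, rule QR, rule QR)
      (simp add: A sum.distrib algebra_simps sum_distrib_left del: fun_upd_apply)
qed

section \<open>Transvections and the permanent\<close>

definition transvection :: "'n \<Rightarrow> 'n \<Rightarrow> complex \<Rightarrow> complex^'n^'n::finite" where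
  "transvection i j x =
     (\<chi> a b. (if a = b then 1 else 0) + (if a = i \<and> b = j then x else 0))"

definition diagonal :: "('n \<Rightarrow> complex) \<Rightarrow> complex^'n^'n::finite" where
  "diagonal d = (\<chi> a b. if a = b then d a else 0)"

lemma transvection_mult:
  "transvection i j x ** A = (\<chi> a b. A $ a $ b + x * (if a = i then A $ j $ b else 0))"
  by (simp add: transvection_def matrix_matrix_mult_def vec_eq_iff distrib_right sum.distrib
      if_distrib[of "\<lambda>t. t * _"] cong: if_cong)

lemma mult_transpose_transvection:
  "A ** transpose (transvection i j x) =
     (\<chi> a b. A $ a $ b + x * (if b = i then A $ a $ j else 0))"
  by (simp add: transvection_def matrix_matrix_mult_def transpose_def vec_eq_iff distrib_left
      sum.distrib if_distrib[of "\<lambda>t. _ * t"] cong: if_cong)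

lemma transvection_0 [simp]: "transvection i j 0 = mat 1"
  by (simp add: transvection_def mat_def vec_eq_iff)

lemma transvection_add:
  assumes "i \<noteq> j"
  shows "transvection i j x ** transvection i j y = transvection i j (x + y)"
  unfolding transvection_mult using assms by (auto simp: transvection_def vec_eq_iff)

lemma det_transvection:
  assumes "i \<noteq> j"
  shows "det (transvection i j x) = 1"
proof -
  have "transvection i j x = (\<chi> k. if k = i then row i (mat 1) + x *s row j (mat 1) else row k (mat 1))"
    by (auto simp: transvection_def row_def mat_def vec_eq_iff)
  then show ?thesis using det_row_operation[OF assms, of "mat 1" x] by simp
qed

lemma diagonal_mult: "diagonal d ** A = (\<chi> a b. d a * A $ a $ b)"
  by (simp add: diagonal_def matrix_matrix_mult_def vec_eq_iff
      if_distrib[of "\<lambda>t. t * _"] cong: if_cong)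

lemma mult_diagonal: "A ** diagonal d = (\<chi> a b. A $ a $ b * d b)"
  by (simp add: diagonal_def matrix_matrix_mult_def vec_eq_iff
      if_distrib[of "\<lambda>t. _ * t"] cong: if_cong)

lemma transpose_diagonal [simp]: "transpose (diagonal d) = diagonal d"
  by (auto simp: diagonal_def transpose_def vec_eq_iff)

lemma det_diagonal_eq: "det (diagonal d) = prod d UNIV"
  by (subst det_diagonal) (auto simp: diagonal_def)

lemma diagonal_transvection:
  assumes "d j \<noteq> 0"
  shows "diagonal d ** transvection i j x = transvection i j (d i / d j * x) ** diagonal d"
  using assms by (auto simp: diagonal_mult mult_diagonal transvection_def vec_eq_iff)

section \<open>Transvections and diagonal matrices against the permanent\<close>

lemma perm_nat_matrix_nonzero:
  fixes X :: "complex^'n^'n::finite"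
  assumes "\<And>a b. X $ a $ b = of_nat (f a b)" and "\<And>a. f a a \<noteq> 0"
  shows "perm X \<noteq> 0"
proof -
  let ?P = "{p. p permutes (UNIV::'n set)}"
  have "perm X = of_nat (\<Sum>p\<in>?P. \<Prod>i\<in>UNIV. f i (p i))"
    by (simp add: perm_def assms(1))
  \<comment> \<open>With natural entries nothing cancels, so the term of the identity permutation is
    a lower bound.\<close>
  moreover have "(\<Sum>p\<in>?P. \<Prod>i\<in>UNIV. f i (p i)) \<ge> (\<Prod>i\<in>UNIV. f i (id i))"
    by (rule member_le_sum) (auto simp: permutes_id[unfolded id_def])
  moreover have "(\<Prod>i\<in>UNIV. f i (id i)) > 0"
    using assms(2) by (auto intro: prod_pos)
  ultimately show ?thesis
    by (metis less_le_trans less_irrefl of_nat_eq_0_iff)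
qed

lemma perm_zero_row:
  assumes "\<And>b. X $ i $ b = 0"
  shows "perm X = 0"
  unfolding perm_def using assms by (intro sum.neutral ballI) (meson UNIV_I finite prod_zero)

lemma perm_zero_column:
  assumes "\<And>a. X $ a $ i = 0"
  shows "perm X = 0"
  unfolding perm_def
proof (intro sum.neutral ballI)
  fix p assume "p \<in> {p. p permutes (UNIV::'a set)}"
  then have "p (inv p i) = i"
    by (simp add: permutes_inverses)
  then show "(\<Prod>a\<in>UNIV. X $ a $ p a) = 0"
    using assms by (metis UNIV_I finite prod_zero)
qed

lemma left_transvection_notin_perm_stab:
  assumes "i \<noteq> j"
  shows "(transvection i j 1, mat 1) \<notin> perm_stab"
proof
  assume "(transvection i j 1, mat 1) \<in> perm_stab"
  \<comment> \<open>Row \<open>i\<close> is zero, so the permanent vanishes. Adding row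
    \<open>j\<close>, which has ones in columns \<open>i\<close> and \<open>j\<close>, to row
    \<open>i\<close> makes every diagonal entry 1.\<close>
  define X :: "complex^'a^'a" where
    "X = (\<chi> a b. if a = i then 0 else if a = b \<or> (a = j \<and> b = i) then 1 else 0)"
  have "perm (transvection i j 1 ** X ** transpose (mat 1)) = perm X"
    using \<open>_ \<in> perm_stab\<close> by (auto simp: perm_stab_def fun_eq_iff)
  moreover have "perm X = 0"
    by (rule perm_zero_row[of _ i]) (simp add: X_def)
  moreover have "perm (transvection i j 1 ** X ** transpose (mat 1)) \<noteq> 0"
    by (rule perm_nat_matrix_nonzero[where f = "\<lambda>a b. if a = b \<or> a = i \<and> b = j \<or> a = j \<and> b = i then 1 else 0"])
      (use assms in \<open>auto simp: transvection_mult X_def\<close>)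
  ultimately show False by simp
qed

lemma right_transvection_notin_perm_stab:
  assumes "i \<noteq> j"
  shows "(mat 1, transvection i j 1) \<notin> perm_stab"
proof
  assume "(mat 1, transvection i j 1) \<in> perm_stab"
  \<comment> \<open>The transpose of the test matrix for the left factor: here column
    \<open>i\<close> is zero until column \<open>j\<close> is added to it.\<close>
  define X :: "complex^'a^'a" where
    "X = (\<chi> a b. if b = i then 0 else if a = b \<or> (b = j \<and> a = i) then 1 else 0)"
  have "perm (mat 1 ** X ** transpose (transvection i j 1)) = perm X"
    using \<open>_ \<in> perm_stab\<close> by (auto simp: perm_stab_def fun_eq_iff)
  moreover have "perm X = 0"
    by (rule perm_zero_column[of _ i]) (simp add: X_def)
  moreover have "perm (mat 1 ** X ** transpose (transvection i j 1)) \<noteq> 0"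
    by (rule perm_nat_matrix_nonzero[where f = "\<lambda>a b. if a = b \<or> a = i \<and> b = j \<or> a = j \<and> b = i then 1 else 0"])
      (use assms in \<open>auto simp: mult_transpose_transvection X_def\<close>)
  ultimately show False by simp
qed

text \<open>Every permutation meets each row and each column exactly once, so every term of the
  permanent is multiplied by the same factor, the product of all \<open>d\<close> and all
  \<open>e\<close>.\<close>

lemma diagonal_in_perm_stab:
  assumes "prod d UNIV = 1" "prod e UNIV = 1"
  shows "(diagonal d, diagonal e) \<in> perm_stab"
proof -
  have "perm (diagonal d ** X ** diagonal e) = perm X" for X
  proof -
    have "(\<Prod>i\<in>UNIV. (diagonal d ** X ** diagonal e) $ i $ p i) = (\<Prod>i\<in>UNIV. X $ i $ p i)"
      if "p permutes UNIV" for p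
    proof -
      have "(\<Prod>i\<in>UNIV. e (p i)) = prod e UNIV"
        using prod.permute[OF that, of e] by (simp add: comp_def)
      then show ?thesis
        using assms by (simp add: diagonal_mult mult_diagonal prod.distrib)
    qed
    then show ?thesis by (simp add: perm_def)
  qed
  then show ?thesis
    using assms by (simp add: perm_stab_def SL_pair_def det_diagonal_eq)
qed

lemma one_in_perm_stab: "(mat 1, mat 1) \<in> perm_stab"
  by (simp add: perm_stab_def SL_pair_def transpose_mat)

text \<open>The two diagonals impose 2n linear conditions on n^2 entries, and equality of the two
  traces makes these conditions dependent; 2n - 1 < n^2 leaves a nonzero solution. It provides the
  coefficients of a relation between root vectors.\<close>

lemma zero_diagonal_conjugate:
  fixes N N' :: "complex^'n^'n::finite"
  assumes "CARD('n) \<ge> 2" and "N ** N' = mat 1"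
  shows "\<exists>Y. Y \<noteq> 0 \<and> (\<forall>i. Y $ i $ i = 0 \<and> (N' ** Y ** N) $ i $ i = 0)"
proof -
  define Y where "Y y = (\<chi> a b. y $ (a, b))" for y :: "complex^('n\<times>'n)"
  define f :: "complex^('n\<times>'n) \<Rightarrow> complex^('n+'n)" where
    "f y = (\<chi> r. case r of Inl i \<Rightarrow> Y y $ i $ i | Inr i \<Rightarrow> (N' ** Y y ** N) $ i $ i)" for y
  have lin: "Vector_Spaces.linear (*s) (*s) f"
    by unfold_locales
      (auto simp: f_def Y_def vec_eq_iff matrix_matrix_mult_def sum.distrib algebra_simps
        sum_distrib_left split: sum.split)
  have "\<not> inj f"
  proof
    assume "inj f"
    then have "vec.dim (range f) = CARD('n \<times> 'n)"
      using vec.dim_image_eq[OF lin, of UNIV] vec_dim_card by (metis inj_on_subset subset_UNIV)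
    moreover have "CARD('n + 'n) \<le> CARD('n \<times> 'n)"
      using assms(1) by (simp add: mult_2[symmetric])
    moreover have "vec.dim (range f) \<le> CARD('n + 'n)"
      by (rule dim_subset_UNIV_cart_gen)
    ultimately have "vec.dim (range f) = CARD('n + 'n)" by linarith
    then have "vec.span (range f) = UNIV"
      using vec.dim_eq_full vec_dim_card vec.span_UNIV by metis
    moreover have "vec.subspace (range f)"
      by (rule vec.linear_subspace_image[OF lin]) simp
    ultimately have "range f = UNIV" by (metis vec.span_eq_iff)
    \<comment> \<open>Counting alone does not settle n = 2, where n^2 = 2n. A preimage of this
      vector would have trace 1 while its conjugate has trace 0; \<open>undefined\<close> is just
      some fixed index.\<close>
    then obtain y where y: "f y = (\<chi> r. if r = Inl undefined then 1 else 0)"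
      by (metis surjD)
    have "trace (N' ** Y y ** N) = trace (Y y)"
      by (metis assms(2) matrix_mul_assoc matrix_mul_lid trace_mul_sym)
    moreover have "Y y $ i $ i = (if i = undefined then 1 else 0)" for i
      using y by (auto simp: f_def vec_eq_iff dest: spec[of _ "Inl i"])
    moreover have "(N' ** Y y ** N) $ i $ i = 0" for i
      using y by (auto simp: f_def vec_eq_iff dest: spec[of _ "Inr i"])
    ultimately show False by (simp add: trace_def)
  qed
  then obtain y where y: "y \<noteq> 0" "f y = 0"
    using vec.linear_inj_iff_eq_0[OF lin] by auto
  have "Y y \<noteq> 0"
    using y(1) by (auto simp: Y_def vec_eq_iff)
  moreover have "Y y $ i $ i = 0" "(N' ** Y y ** N) $ i $ i = 0" for i
    using y(2) by (auto simp: f_def vec_eq_iff dest: spec[of _ "Inl i"] spec[of _ "Inr i"])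
  ultimately show ?thesis by blast
qed

section \<open>Root subgroups and the diagonal torus of one factor\<close>

definition at_place :: "'k \<Rightarrow> 'n::finite mat_pair \<Rightarrow> 'k \<Rightarrow> 'n mat_pair" where
  "at_place l m = tuple_one(l := m)"

text \<open>The roots of \<open>SL\<^sub>n \<times> SL\<^sub>n\<close> relative to its diagonal torus; the Boolean tells
  the two factors apart.\<close>

definition roots :: "(bool \<times> 'n \<times> 'n) set" where
  "roots = {(b, i, j). i \<noteq> j}"

definition root_elem :: "bool \<times> 'n \<times> 'n \<Rightarrow> complex \<Rightarrow> 'n::finite mat_pair" where
  "root_elem r x = (case r of (b, i, j) \<Rightarrow>
     if b then (transvection i j x, mat 1) else (mat 1, transvection i j x))"

text \<open>In exponential coordinates determinant one becomes a vanishing sum of exponents, and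
  real exponents let characters be compared by injectivity of the real exponential.\<close>

definition torus_elem :: "(bool \<times> 'n \<Rightarrow> real) \<Rightarrow> 'n::finite mat_pair" where
  "torus_elem e = (diagonal (\<lambda>i. exp (complex_of_real (e (True, i)))),
                   diagonal (\<lambda>i. exp (complex_of_real (e (False, i)))))"

text \<open>The factor by which conjugation with \<open>torus_elem e\<close> rescales the parameter
  of the root subgroup of \<open>r\<close>.\<close>

definition root_char :: "(bool \<times> 'n \<Rightarrow> real) \<Rightarrow> bool \<times> 'n \<times> 'n \<Rightarrow> complex" where
  "root_char e r = (case r of (b, i, j) \<Rightarrow>
     exp (complex_of_real (e (b, i))) / exp (complex_of_real (e (b, j))))"

lemma tuple_mult_at_place_left:
  "tuple_mult (at_place l m) \<sigma> = \<sigma>(l := (fst m ** fst (\<sigma> l), snd m ** snd (\<sigma> l)))"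
  by (auto simp: tuple_mult_def at_place_def tuple_one_def)

lemma tuple_mult_at_place_right:
  "tuple_mult \<sigma> (at_place l m) = \<sigma>(l := (fst (\<sigma> l) ** fst m, snd (\<sigma> l) ** snd m))"
  by (auto simp: tuple_mult_def at_place_def tuple_one_def)

lemma at_place_mult:
  "tuple_mult (at_place l m) (at_place l m') = at_place l (fst m ** fst m', snd m ** snd m')"
  by (auto simp: tuple_mult_def at_place_def tuple_one_def)

lemma at_place_in_power:
  assumes "m \<in> T" "(mat 1, mat 1) \<in> T"
  shows "at_place l m \<in> UNIV \<rightarrow> T"
  using assms by (auto simp: at_place_def tuple_one_def)

lemma SL_pair_iff: "m \<in> SL_pair \<longleftrightarrow> det (fst m) = 1 \<and> det (snd m) = 1"
  by (simp add: SL_pair_def case_prod_unfold)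

lemma root_elem_in_SL:
  assumes "r \<in> roots"
  shows "at_place l (root_elem r x) \<in> UNIV \<rightarrow> SL_pair"
  using assms
  by (intro at_place_in_power)
    (auto simp: roots_def root_elem_def SL_pair_def det_transvection split: if_splits)

lemma root_elem_0 [simp]: "at_place l (root_elem r 0) = tuple_one"
  by (auto simp: at_place_def root_elem_def tuple_one_def split: prod.split)

lemma root_elem_add:
  assumes "r \<in> roots"
  shows "tuple_mult (at_place l (root_elem r x)) (at_place l (root_elem r y)) =
    at_place l (root_elem r (x + y))"
  using assms by (auto simp: at_place_mult root_elem_def roots_def transvection_add)

lemma root_elem_notin_perm_stab:
  assumes "r \<in> roots"
  shows "at_place l (root_elem r 1) \<notin> UNIV \<rightarrow> perm_stab"
proof
  assume "at_place l (root_elem r 1) \<in> UNIV \<rightarrow> perm_stab"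
  then have "at_place l (root_elem r 1) l \<in> perm_stab" by blast
  then show False
    using assms by (auto simp: at_place_def root_elem_def roots_def
        left_transvection_notin_perm_stab right_transvection_notin_perm_stab split: if_splits)
qed

lemma torus_elem_in_perm_stab:
  assumes "\<And>b. (\<Sum>i\<in>UNIV. e (b, i)) = 0"
  shows "at_place l (torus_elem e) \<in> UNIV \<rightarrow> perm_stab"
  unfolding torus_elem_def
  using assms
  by (intro at_place_in_power diagonal_in_perm_stab one_in_perm_stab)
    (simp_all add: exp_sum[symmetric] of_real_sum[symmetric] del: of_real_sum)

lemma torus_root_elem:
  "tuple_mult (at_place l (torus_elem e)) (at_place l (root_elem r x)) =
   tuple_mult (at_place l (root_elem r (root_char e r * x))) (at_place l (torus_elem e))"
proof -
  obtain b i j where "r = (b, i, j)" by (cases r)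
  then show ?thesis
    using diagonal_transvection[of "\<lambda>i. exp (complex_of_real (e (b, i)))" j i x]
    by (cases b) (simp_all add: at_place_mult torus_elem_def root_elem_def root_char_def)
qed

section \<open>A torus element on which all roots take different values\<close>

lemma power2_difference_inject:
  fixes p q p' q' :: nat
  assumes "p \<noteq> q" "p' \<noteq> q'" and eq: "(2::real) ^ p - 2 ^ q = 2 ^ p' - 2 ^ q'"
  shows "p = p' \<and> q = q'"
proof -
  \<comment> \<open>Both \<open>2 ^ x\<close> and \<open>2 ^ y'\<close> are at most half of
    \<open>2 ^ x'\<close>, so the larger leading power decides.\<close>
  have less: "(2::real) ^ x - 2 ^ y < 2 ^ x' - 2 ^ y'" if "x < x'" "y' < x'" for x y x' y' :: nat
  proof -
    have "(2::real) ^ Suc x \<le> 2 ^ x'" "(2::real) ^ Suc y' \<le> 2 ^ x'"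
      using that by (intro power_increasing; simp)+
    moreover have "(2::real) ^ y > 0" by simp
    ultimately show ?thesis unfolding power_Suc by linarith
  qed
  have main: "x = x' \<and> y = y'"
    if "y < x" and x': "x' \<noteq> y'" and e: "(2::real) ^ x - 2 ^ y = 2 ^ x' - 2 ^ y'" for x y x' y' :: nat
  proof -
    have "(2::real) ^ y < 2 ^ x" using \<open>y < x\<close> by simp
    then have "(2::real) ^ y' < 2 ^ x'" using e by linarith
    then have "y' < x'" by simp
    have "x = x'"
      using less[of x x' y' y] less[of x' x y y'] \<open>y < x\<close> \<open>y' < x'\<close> e
      by (metis less_irrefl nat_neq_iff)
    then show ?thesis using e by simp
  qed
  show ?thesis
  proof (cases "q < p")
    case True
    then show ?thesis using main[of q p p' q'] assms by blast
  next
    case False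
    moreover have "(2::real) ^ q - 2 ^ p = 2 ^ q' - 2 ^ p'" using eq by linarith
    ultimately show ?thesis using main[of p q q' p'] assms by auto
  qed
qed

lemma regular_torus_elem_exists:
  "\<exists>e :: bool \<times> 'n::finite \<Rightarrow> real. (\<forall>b. (\<Sum>i\<in>UNIV. e (b, i)) = 0) \<and> inj_on (root_char e) roots"
proof -
  obtain k :: "bool \<times> 'n \<Rightarrow> nat" where k: "inj k"
    using finite_imp_inj_to_nat_seg[of "UNIV :: (bool \<times> 'n) set"] by auto
  \<comment> \<open>All 2n indices receive different powers of two. Subtracting the mean within each
    factor makes the sums zero and cancels in the differences on which \<open>root_char\<close>
    depends.\<close>
  define e :: "bool \<times> 'n \<Rightarrow> real" where
    "e = (\<lambda>(b, i). 2 ^ k (b, i) - (\<Sum>j\<in>UNIV. 2 ^ k (b, j)) / CARD('n))"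
  have "(\<Sum>i\<in>UNIV. e (b, i)) = 0" for b
    by (simp add: e_def sum_subtractf)
  moreover have "inj_on (root_char e) roots"
  proof (rule inj_onI, clarsimp simp: roots_def)
    fix b i j b' i' j'
    assume ne: "i \<noteq> j" "i' \<noteq> j'" and eq: "root_char e (b, i, j) = root_char e (b', i', j')"
    then have "exp (e (b, i) - e (b, j)) = exp (e (b', i') - e (b', j'))"
      unfolding root_char_def by (simp add: exp_of_real of_real_divide[symmetric] exp_diff
        del: of_real_divide)
    then have "(2::real) ^ k (b, i) - 2 ^ k (b, j) = 2 ^ k (b', i') - 2 ^ k (b', j')"
      by (simp add: e_def)
    then show "b = b' \<and> i = i' \<and> j = j'"
      using power2_difference_inject[of "k (b, i)" "k (b, j)" "k (b', i')" "k (b', j')"] ne k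
      by (simp add: inj_eq)
  qed
  ultimately show ?thesis by blast
qed

section \<open>The infinitesimal action of root vectors\<close>

text \<open>The value of \<open>\<phi>\<close> on the image of \<open>v\<close> under the root
  vector in the Lie algebra. Testing against functionals keeps the calculus in the complex numbers,
  as \<open>W\<close> carries no topology.\<close>

definition root_deriv ::
    "(('k \<Rightarrow> 'n::finite mat_pair) \<Rightarrow> 'w \<Rightarrow> 'w) \<Rightarrow> 'k \<Rightarrow> bool \<times> 'n \<times> 'n \<Rightarrow> ('w \<Rightarrow> complex) \<Rightarrow> 'w \<Rightarrow> complex" where
  "root_deriv \<rho> l r \<phi> v = deriv (\<lambda>x. \<phi> (\<rho> (at_place l (root_elem r x)) v)) 0"

lemma matrix_inv_unique:
  fixes K :: "'a::field^'n^'n::finite"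
  assumes "K ** K' = mat 1"
  shows "matrix_inv K = K'"
proof -
  have K': "K' ** K = mat 1" using assms matrix_left_right_inverse by blast
  then have "invertible K" using assms by (auto simp: invertible_def)
  then have "matrix_inv K ** K = mat 1"
    unfolding matrix_inv_def invertible_def by (rule someI2_ex) simp
  then show ?thesis
    using arg_cong[OF assms, of "\<lambda>M. matrix_inv K ** M"] by (simp add: matrix_mul_assoc)
qed

text \<open>Serves two cases: \<open>S\<close> the power of \<open>SL_pair\<close>, for the orbit,
  and \<open>S = UNIV\<close>, for the extension to singular matrices.\<close>

locale tuple_rep = vector_space s
  for s :: "complex \<Rightarrow> 'w::ab_group_add \<Rightarrow> 'w" +
  fixes S :: "('k \<Rightarrow> 'n::finite mat_pair) set" and \<rho> :: "('k \<Rightarrow> 'n mat_pair) \<Rightarrow> 'w \<Rightarrow> 'w"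
  assumes rep: "polynomial_rep s S \<rho>"
    and SL_subset: "(UNIV \<rightarrow> SL_pair) \<subseteq> S"
    and mult_closed: "g \<in> S \<Longrightarrow> h \<in> S \<Longrightarrow> tuple_mult g h \<in> S"
begin

section \<open>Linear functionals and matrix coefficients\<close>

abbreviation functional :: "('w \<Rightarrow> complex) \<Rightarrow> bool" where
  "functional \<equiv> Vector_Spaces.linear s (*)"

lemma linear_rep: "g \<in> S \<Longrightarrow> Vector_Spaces.linear s s (\<rho> g)"
  using rep by (simp add: polynomial_rep_def)

lemma
  assumes "g \<in> S"
  shows rep_add: "\<rho> g (v + w) = \<rho> g v + \<rho> g w"
    and rep_scale: "\<rho> g (s c v) = s c (\<rho> g v)"
proof -
  interpret g: Vector_Spaces.linear s s "\<rho> g" using assms by (rule linear_rep)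
  show "\<rho> g (v + w) = \<rho> g v + \<rho> g w" "\<rho> g (s c v) = s c (\<rho> g v)"
    by (rule g.add, rule g.scale)
qed

lemma rep_one: "\<rho> tuple_one v = v"
  using rep by (simp add: polynomial_rep_def)

lemma rep_mult: "g \<in> S \<Longrightarrow> h \<in> S \<Longrightarrow> \<rho> (tuple_mult g h) v = \<rho> g (\<rho> h v)"
  using rep by (simp add: polynomial_rep_def)

lemma rep_coefficient:
  assumes "functional \<phi>"
  obtains q where "polynomial_fun tuple_entries q" "\<And>g. g \<in> S \<Longrightarrow> \<phi> (\<rho> g v) = q g"
  using rep assms unfolding polynomial_rep_def by blast

lemma functional_comp_rep:
  assumes "functional \<phi>" "g \<in> S"
  shows "functional (\<lambda>v. \<phi> (\<rho> g v))"
proof -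
  interpret \<phi>: Vector_Spaces.linear s "(*)" \<phi> by fact
  interpret g: Vector_Spaces.linear s s "\<rho> g" using assms linear_rep by blast
  show ?thesis by unfold_locales (simp_all add: g.add g.scale \<phi>.add \<phi>.scale)
qed

lemma functionals_separate:
  assumes "\<And>\<phi>. functional \<phi> \<Longrightarrow> \<phi> v = \<phi> v'"
  shows "v = v'"
proof (rule ccontr)
  interpret pair: vector_space_pair s "(*) :: complex \<Rightarrow> complex \<Rightarrow> complex" ..
  assume "v \<noteq> v'"
  then have "independent {v - v'}" by (simp add: independent_insert)
  then obtain \<phi> where \<phi>: "functional \<phi>" "\<phi> (v - v') = 1"
    using pair.linear_independent_extend[of "{v - v'}" "\<lambda>_. 1"] by auto
  interpret \<phi>: Vector_Spaces.linear s "(*)" \<phi> by fact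
  show False using \<phi>(2) assms[OF \<phi>(1)] by (simp add: \<phi>.diff)
qed

lemma rep_curve:
  assumes "functional \<phi>" and "\<And>x. c x \<in> S"
    and "\<And>l i j. \<exists>P. \<forall>x. fst (c x l) $ i $ j = poly P x"
    and "\<And>l i j. \<exists>P. \<forall>x. snd (c x l) $ i $ j = poly P x"
  shows "\<exists>P. \<forall>x. \<phi> (\<rho> (c x) v) = poly P x"
proof -
  obtain q where "polynomial_fun tuple_entries q" and q: "\<And>g. g \<in> S \<Longrightarrow> \<phi> (\<rho> g v) = q g"
    using rep_coefficient[OF assms(1)] by blast
  have "\<exists>P. \<forall>x. q (c x) = poly P x"
    by (rule polynomial_fun_curve[OF \<open>polynomial_fun tuple_entries q\<close>])
      (use assms(3,4) in \<open>auto simp: tuple_entries_def\<close>)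
  then show ?thesis using q assms(2) by simp
qed

section \<open>Differentiation along root subgroups\<close>

lemma root_curve:
  assumes "functional \<phi>" "r \<in> roots"
  shows "\<exists>P. \<forall>x. \<phi> (\<rho> (at_place l (root_elem r x)) v) = poly P x"
proof -
  have "\<exists>P. \<forall>x. transvection i j x $ a $ b = poly P x" for i j a b :: 'n
    by (rule exI[of _ "[:if a = b then 1 else 0, if a = i \<and> b = j then 1 else 0:]"])
      (auto simp: transvection_def)
  moreover have "\<exists>P. \<forall>x. mat 1 $ a $ b = poly P x" for a b :: 'n
    by (metis poly_pCons poly_0 add.right_neutral mult_zero_right)
  ultimately have "(\<exists>P. \<forall>x. fst (at_place l (root_elem r x) m) $ a $ b = poly P x) \<and>
      (\<exists>P. \<forall>x. snd (at_place l (root_elem r x) m) $ a $ b = poly P x)" for m a b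
    by (cases r; cases "fst r"; cases "m = l")
      (simp_all add: at_place_def root_elem_def tuple_one_def)
  then show ?thesis
    using assms(1) subsetD[OF SL_subset root_elem_in_SL[OF assms(2)]]
    by (intro rep_curve) auto
qed

lemma root_deriv:
  assumes "functional \<phi>" "r \<in> roots"
  shows "((\<lambda>x. \<phi> (\<rho> (at_place l (root_elem r x)) v)) has_field_derivative root_deriv \<rho> l r \<phi> v) (at 0)"
proof -
  obtain P where "\<And>x. \<phi> (\<rho> (at_place l (root_elem r x)) v) = poly P x"
    using root_curve[OF assms] by blast
  then show ?thesis
    unfolding root_deriv_def by (simp add: DERIV_deriv_iff_field_differentiable
      field_differentiable_def) (use poly_DERIV in blast)
qed

lemma functional_root_deriv:
  assumes "functional \<phi>" "r \<in> roots"
  shows "functional (root_deriv \<rho> l r \<phi>)"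
proof -
  interpret \<phi>: Vector_Spaces.linear s "(*)" \<phi> by fact
  have u: "at_place l (root_elem r x) \<in> S" for x
    by (rule subsetD[OF SL_subset root_elem_in_SL[OF assms(2)]])
  have "root_deriv \<rho> l r \<phi> (v + w) = root_deriv \<rho> l r \<phi> v + root_deriv \<rho> l r \<phi> w" for v w
    using DERIV_unique[OF root_deriv[OF assms, of l "v + w"]]
      DERIV_add[OF root_deriv[OF assms, of l v] root_deriv[OF assms, of l w]]
    by (simp only: rep_add[OF u] \<phi>.add)
  moreover have "root_deriv \<rho> l r \<phi> (s c v) = c * root_deriv \<rho> l r \<phi> v" for c v
    using DERIV_unique[OF root_deriv[OF assms, of l "s c v"]]
      DERIV_cmult[OF root_deriv[OF assms, of l v], of c]
    by (simp only: rep_scale[OF u] \<phi>.scale)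
  ultimately show ?thesis
    by unfold_locales
qed

text \<open>By the one-parameter group law, the derivative of a coefficient at \<open>x\<close> is
  the derivative at 0 for the functional precomposed with the action of the element at
  \<open>x\<close>. The hypothesis covers all functionals, so every coefficient is constant.\<close>

lemma fixed_by_root_elem:
  assumes "r \<in> roots" and "\<And>\<phi>. functional \<phi> \<Longrightarrow> root_deriv \<rho> l r \<phi> v = 0"
  shows "\<rho> (at_place l (root_elem r x)) v = v"
proof (rule functionals_separate)
  fix \<phi> assume \<phi>: "functional \<phi>"
  define u where "u x = at_place l (root_elem r x)" for x
  have u: "u x \<in> S" for x
    using subsetD[OF SL_subset root_elem_in_SL[OF assms(1)]] by (simp add: u_def)
  obtain P where P: "\<And>x. \<phi> (\<rho> (u x) v) = poly P x"
    using root_curve[OF \<phi> assms(1)] unfolding u_def by blast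
  have "((\<lambda>x. \<phi> (\<rho> (u x) v)) has_field_derivative 0) (at x)" for x
  proof -
    have "\<phi> (\<rho> (u x) (\<rho> (u y) v)) = \<phi> (\<rho> (u (x + y)) v)" for y
      using rep_mult[OF u u, of x y v] root_elem_add[OF assms(1), of l x y]
      by (simp add: u_def)
    then have "((\<lambda>y. \<phi> (\<rho> (u (x + y)) v)) has_field_derivative 0) (at 0)"
      using root_deriv[OF functional_comp_rep[OF \<phi> u] assms(1), of x l v]
        assms(2)[OF functional_comp_rep[OF \<phi> u], of x]
      by (simp add: u_def)
    then show ?thesis
      using DERIV_shift[of "\<lambda>x. \<phi> (\<rho> (u x) v)" 0 0 x] by (simp add: add.commute)
  qed
  then have "\<phi> (\<rho> (u x) v) = \<phi> (\<rho> (u 0) v)"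

    using has_field_derivative_zero_constant[of UNIV "\<lambda>x. \<phi> (\<rho> (u x) v)"] by auto
  then show "\<phi> (\<rho> (at_place l (root_elem r x)) v) = \<phi> v"
    by (simp add: u_def rep_one)
qed

text \<open>Weight vectors for a torus element \<open>t\<close> are separated by applying \<open>\<rho> t - c\<close> for the
  unwanted weights \<open>c\<close>.\<close>

lemma weight_separation:
  assumes fixed: "\<rho> (at_place l (torus_elem e)) v = v" and t: "at_place l (torus_elem e) \<in> S"
    and "functional \<psi>" "finite C"
  shows "\<exists>\<phi>. functional \<phi> \<and> (\<forall>r\<in>roots.
    root_deriv \<rho> l r \<phi> v = (\<Prod>c\<in>C. root_char e r - c) * root_deriv \<rho> l r \<psi> v)"
  using assms(4)
proof (induction C rule: finite_induct)
  case empty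
  then show ?case using assms(3) by auto
next
  case (insert c C)
  then obtain \<phi> where \<phi>: "functional \<phi>" and rd: "\<And>r. r \<in> roots \<Longrightarrow>
    root_deriv \<rho> l r \<phi> v = (\<Prod>c\<in>C. root_char e r - c) * root_deriv \<rho> l r \<psi> v"
    by blast
  let ?t = "at_place l (torus_elem e)"
  define \<phi>' where "\<phi>' w = \<phi> (\<rho> ?t w) - c * \<phi> w" for w
  interpret \<phi>: Vector_Spaces.linear s "(*)" \<phi> by fact
  interpret \<phi>t: Vector_Spaces.linear s "(*)" "\<lambda>w. \<phi> (\<rho> ?t w)"
    by (rule functional_comp_rep[OF \<phi> t])
  have "functional \<phi>'"
    by unfold_locales (simp_all add: \<phi>'_def \<phi>.add \<phi>.scale \<phi>t.add \<phi>t.scale algebra_simps)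
  moreover have "root_deriv \<rho> l r \<phi>' v = (root_char e r - c) * root_deriv \<rho> l r \<phi> v"
    if r: "r \<in> roots" for r
  proof -
    have u: "at_place l (root_elem r x) \<in> S" for x
      by (rule subsetD[OF SL_subset root_elem_in_SL[OF r]])
    \<comment> \<open>Moving the torus element past the root element rescales the parameter by the
      character, and then the torus element is absorbed by \<open>v\<close>.\<close>
    have "\<phi> (\<rho> ?t (\<rho> (at_place l (root_elem r x)) v)) =
        \<phi> (\<rho> (at_place l (root_elem r (root_char e r * x))) v)" for x
      using rep_mult[OF t u[of x], of v] rep_mult[OF u[of "root_char e r * x"] t, of v]
      by (simp add: torus_root_elem fixed)
    moreover have "((\<lambda>x. \<phi> (\<rho> (at_place l (root_elem r (root_char e r * x))) v))
        has_field_derivative root_deriv \<rho> l r \<phi> v * root_char e r) (at 0)"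
      by (rule DERIV_chain'[where f = "\<lambda>x. root_char e r * x"];
          (auto intro!: derivative_eq_intros)[1])
        (simp add: root_deriv[OF \<phi> r])
    ultimately have "((\<lambda>x. \<phi>' (\<rho> (at_place l (root_elem r x)) v)) has_field_derivative
        root_deriv \<rho> l r \<phi> v * root_char e r - c * root_deriv \<rho> l r \<phi> v) (at 0)"
      unfolding \<phi>'_def
      by (intro DERIV_diff DERIV_cmult root_deriv[OF \<phi> r]) simp
    then show ?thesis
      unfolding root_deriv_def[of _ _ _ \<phi>'] by (subst DERIV_imp_deriv) (auto simp: algebra_simps)
  qed
  ultimately show ?case
    using rd insert.hyps by (intro exI[of _ \<phi>']) simp
qed

text \<open>Modulo the stabilizer of \<open>v\<close>, the second matrix at place \<open>l\<close> can be moved to the first one,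
  so all root subgroups act on \<open>\<rho> \<sigma> v\<close> by moving the single matrix \<open>fst (\<sigma> l)\<close> along lines.\<close>

lemma root_relation:
  assumes n: "CARD('n) \<ge> 2" and v: "(UNIV \<rightarrow> trace_stab) \<subseteq> stabilizer \<rho> v"
    and \<sigma>: "\<sigma> \<in> S" "det (fst (\<sigma> l)) \<noteq> 0" "det (snd (\<sigma> l)) \<noteq> 0"
  shows "\<exists>c :: complex^(bool \<times> 'n \<times> 'n). c \<noteq> 0 \<and> (\<forall>r. r \<notin> roots \<longrightarrow> c $ r = 0) \<and>
    (\<forall>\<phi>. functional \<phi> \<longrightarrow> (\<Sum>r\<in>roots. c $ r * root_deriv \<rho> l r \<phi> (\<rho> \<sigma> v)) = 0)"
proof -
  obtain A B where AB: "\<sigma> l = (A, B)" by fastforce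
  obtain A' where A': "A ** A' = mat 1" "A' ** A = mat 1"
    using \<sigma>(2) AB by (auto simp: invertible_det_nz[symmetric] invertible_def)
  obtain B' where B': "B ** B' = mat 1" "B' ** B = mat 1"
    using \<sigma>(3) AB by (auto simp: invertible_det_nz[symmetric] invertible_def)
  \<comment> \<open>\<open>N\<close> does not change when \<open>(A, B)\<close> is multiplied on the
    right by an element of \<open>trace_stab\<close>; \<open>N'\<close> is its inverse.\<close>
  define N where "N = A ** transpose B"
  define N' where "N' = transpose B' ** A'"
  have BT: "transpose B ** transpose B' = mat 1"
    by (simp add: matrix_transpose_mul[symmetric] B' transpose_mat)
  have NN': "N ** N' = mat 1"
  proof -
    have "N ** N' = A ** (transpose B ** transpose B') ** A'"
      by (simp only: N_def N'_def matrix_mul_assoc)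
    then show ?thesis by (simp add: BT A')
  qed
  have NB': "N ** transpose B' = A"
    by (simp add: N_def matrix_mul_assoc[symmetric] BT)
  obtain Y where Y: "Y \<noteq> 0" "\<And>i. Y $ i $ i = 0" "\<And>i. (N' ** Y ** N) $ i $ i = 0"
    using zero_diagonal_conjugate[OF n NN'] by blast
  \<comment> \<open>The zero diagonals of \<open>Y\<close> and of its conjugate are what makes
    \<open>c\<close> vanish outside \<open>roots\<close>.\<close>
  define c :: "complex^(bool \<times> 'n \<times> 'n)" where
    "c = (\<chi> r. case r of (b, i, j) \<Rightarrow> if b then Y $ i $ j else - (N' ** Y ** N) $ j $ i)"
  \<comment> \<open>The velocity of the first matrix: E_ij A for a root of the first factor, and N
    E_ji (B^-1)^T for one of the second, after the motion of B has been transferred to A.\<close>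
  define D :: "bool \<times> 'n \<times> 'n \<Rightarrow> complex^'n^'n" where
    "D r = (case r of (b, i, j) \<Rightarrow> \<chi> a d.
       if b then if a = i then A $ j $ d else 0 else N $ a $ j * B' $ d $ i)" for r
  define \<tau> where "\<tau> r x = \<sigma>(l := (\<chi> a d. A $ a $ d + x * D r $ a $ d, B))" for r x
  have curve: "\<tau> r x \<in> S \<and> \<rho> (at_place l (root_elem r x)) (\<rho> \<sigma> v) = \<rho> (\<tau> r x) v"
    if r: "r \<in> roots" for r x
  proof -
    let ?u = "at_place l (root_elem r x)"
    have u: "?u \<in> S" by (rule subsetD[OF SL_subset root_elem_in_SL[OF r]])
    obtain b i j where bij: "r = (b, i, j)" "i \<noteq> j" using r by (auto simp: roots_def)
    show ?thesis
    proof (cases b)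
      case True
      then have "\<tau> r x = tuple_mult ?u \<sigma>"
        by (simp add: tuple_mult_at_place_left bij AB \<tau>_def root_elem_def D_def
            transvection_mult)
      then show ?thesis using rep_mult[OF u \<sigma>(1)] mult_closed[OF u \<sigma>(1)] by simp
    next
      case False
      \<comment> \<open>\<open>K\<close> solves the equation that right multiplication by
        \<open>K\<close> and its inverse transpose restores B after the transvection. This factor
        fixes \<open>v\<close>, and the first matrix becomes \<open>A ** K\<close>.\<close>
      define K where "K = transpose B ** transpose (transvection i j x) ** transpose B'"
      define K' where "K' = transpose B ** transpose (transvection i j (-x)) ** transpose B'"
      have uu: "transpose (transvection i j x) ** transpose (transvection i j (-x)) = mat 1"
        by (simp add: matrix_transpose_mul[symmetric] transvection_add bij(2) transpose_mat)
      have B'T: "transpose B' ** transpose B = mat 1"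
        by (simp add: matrix_transpose_mul[symmetric] B' transpose_mat)
      have KK': "K ** K' = mat 1"
      proof -
        have "K ** K' = transpose B ** (transpose (transvection i j x) ** (transpose B' ** transpose B)
            ** transpose (transvection i j (-x))) ** transpose B'"
          by (simp only: K_def K'_def matrix_mul_assoc)
        then show ?thesis by (simp add: B'T uu BT)
      qed
      have "det K = 1"
        using arg_cong[OF BT, of det]
        by (simp add: K_def det_mul det_transvection bij(2) mult.commute)
      then have k: "at_place l (K, transpose K') \<in> UNIV \<rightarrow> trace_stab"
        by (intro at_place_in_power)
          (auto simp: trace_stab_def matrix_inv_unique[OF KK'] transpose_mat
            matrix_inv_unique[of "mat 1" "mat 1"] intro!: exI[of _ K] exI[of _ "mat 1"])
      then have kS: "at_place l (K, transpose K') \<in> S"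
          and kv: "\<rho> (at_place l (K, transpose K')) v = v"
        using v SL_subset by (auto simp: stabilizer_def)
      have "A ** K = N ** transpose (transvection i j x) ** transpose B'"
        by (simp add: K_def N_def matrix_mul_assoc)
      also have "\<dots> = (\<chi> a d. A $ a $ d + x * D r $ a $ d)"
      proof -
        have "(N ** transpose (transvection i j x) ** transpose B') $ a $ d =
            (N ** transpose B') $ a $ d + x * (N $ a $ j * B' $ d $ i)" for a d
          unfolding mult_transpose_transvection
          by (simp add: matrix_matrix_mult_def transpose_def
              distrib_right sum.distrib if_distrib[of "\<lambda>t. _ * t"] if_distrib[of "\<lambda>t. t * _"]
              cong: if_cong)
        then show ?thesis by (simp add: NB' D_def bij False vec_eq_iff)
      qed
      finally have AK: "A ** K = (\<chi> a d. A $ a $ d + x * D r $ a $ d)" .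
      have "transvection i j x ** B ** transpose K' = B"
      proof -
        have "transpose K' = B' ** (transvection i j (-x) ** B)"
          by (simp add: K'_def matrix_transpose_mul matrix_mul_assoc)
        then have "transvection i j x ** B ** transpose K' =
            transvection i j x ** (B ** B') ** transvection i j (-x) ** B"
          by (simp only: matrix_mul_assoc)
        then show ?thesis by (simp add: B' transvection_add bij(2))
      qed
      then have "\<tau> r x = tuple_mult (tuple_mult ?u \<sigma>) (at_place l (K, transpose K'))"
        using False AK
        by (simp add: tuple_mult_at_place_left tuple_mult_at_place_right bij AB \<tau>_def root_elem_def)
      then show ?thesis
        using rep_mult[OF u \<sigma>(1)] rep_mult[OF mult_closed[OF u \<sigma>(1)] kS]
          mult_closed[OF mult_closed[OF u \<sigma>(1)] kS] kv by simp
    qed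
  qed
  \<comment> \<open>The first factor contributes Y A. The second contributes -N (N^-1 Y N) (B^-1)^T,
    which is -Y A because N (B^-1)^T = A.\<close>
  have cD: "(\<Sum>r\<in>UNIV. c $ r * D r $ a $ d) = 0" for a d
  proof -
    have "(\<Sum>r\<in>UNIV. c $ r * D r $ a $ d) =
        (\<Sum>b\<in>UNIV. \<Sum>i\<in>UNIV. \<Sum>j\<in>UNIV. c $ (b, i, j) * D (b, i, j) $ a $ d)"
      by (simp add: UNIV_Times_UNIV[symmetric] sum.cartesian_product' del: UNIV_Times_UNIV)
    also have "\<dots> = (\<Sum>i\<in>UNIV. \<Sum>j\<in>UNIV. c $ (True, i, j) * D (True, i, j) $ a $ d)
        + (\<Sum>i\<in>UNIV. \<Sum>j\<in>UNIV. c $ (False, i, j) * D (False, i, j) $ a $ d)"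
      by (simp add: UNIV_bool)
    also have "(\<Sum>i\<in>UNIV. \<Sum>j\<in>UNIV. c $ (True, i, j) * D (True, i, j) $ a $ d) = (Y ** A) $ a $ d"
      by (subst sum.swap) (simp add: c_def D_def matrix_matrix_mult_def
          if_distrib[of "\<lambda>t. _ * t"] cong: if_cong)
    also have "(\<Sum>i\<in>UNIV. \<Sum>j\<in>UNIV. c $ (False, i, j) * D (False, i, j) $ a $ d) =
        - (N ** (N' ** Y ** N) ** transpose B') $ a $ d"
    proof -
      have "(N ** M ** transpose B') $ a $ d = (\<Sum>i\<in>UNIV. \<Sum>j\<in>UNIV. M $ j $ i * (N $ a $ j * B' $ d $ i))"
        for M
        by (simp add: matrix_matrix_mult_def transpose_def sum_distrib_right mult.assoc
            mult.left_commute)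
      then show ?thesis by (simp add: c_def D_def sum_negf)
    qed
    also have "N ** (N' ** Y ** N) ** transpose B' = Y ** A"
    proof -
      have "N ** (N' ** Y ** N) ** transpose B' = (N ** N') ** Y ** (N ** transpose B')"
        by (simp only: matrix_mul_assoc)
      then show ?thesis by (simp add: NB' NN')
    qed
    finally show ?thesis by simp
  qed
  have c0: "c $ r = 0" if "r \<notin> roots" for r
    using that Y(2,3) by (auto simp: roots_def c_def split: if_splits)
  have "c \<noteq> 0"
  proof
    assume "c = 0"
    then have "c $ (True, i, j) = 0" for i j by simp
    then show False using Y(1) by (simp add: c_def vec_eq_iff)
  qed
  moreover have "(\<Sum>r\<in>roots. c $ r * root_deriv \<rho> l r \<phi> (\<rho> \<sigma> v)) = 0" if \<phi>: "functional \<phi>" for \<phi>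
  proof -
    obtain q where q: "polynomial_fun tuple_entries q" "\<And>g. g \<in> S \<Longrightarrow> \<phi> (\<rho> g v) = q g"
      using rep_coefficient[OF \<phi>] by blast
    obtain Q where Q: "\<And>D. ((\<lambda>x. q (\<sigma>(l := (\<chi> a b. A $ a $ b + x * D $ a $ b, B))))
           has_field_derivative (\<Sum>a\<in>UNIV. \<Sum>b\<in>UNIV. Q a b * D $ a $ b)) (at 0)"
      using polynomial_fun_gradient[OF q(1)] by blast
    have "root_deriv \<rho> l r \<phi> (\<rho> \<sigma> v) = (\<Sum>a\<in>UNIV. \<Sum>b\<in>UNIV. Q a b * D r $ a $ b)"
      if "r \<in> roots" for r
      unfolding root_deriv_def
      using Q[of "D r"] curve[OF that] q(2) by (intro DERIV_imp_deriv) (simp add: \<tau>_def)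
    then have "(\<Sum>r\<in>roots. c $ r * root_deriv \<rho> l r \<phi> (\<rho> \<sigma> v)) =
        (\<Sum>r\<in>roots. c $ r * (\<Sum>a\<in>UNIV. \<Sum>b\<in>UNIV. Q a b * D r $ a $ b))"
      by simp
    also have "\<dots> = (\<Sum>r\<in>UNIV. c $ r * (\<Sum>a\<in>UNIV. \<Sum>b\<in>UNIV. Q a b * D r $ a $ b))"
      by (rule sum.mono_neutral_left) (auto simp: c0)
    also have "\<dots> = (\<Sum>a\<in>UNIV. \<Sum>b\<in>UNIV. Q a b * (\<Sum>r\<in>UNIV. c $ r * D r $ a $ b))"
      unfolding sum_distrib_left
      by (subst sum.swap, rule sum.cong[OF refl], subst sum.swap) (simp add: mult.left_commute)
    also have "\<dots> = 0" by (simp add: cD)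
    finally show ?thesis .
  qed
  ultimately show ?thesis using c0 by blast
qed

end

section \<open>A form vanishing on trace-like orbits\<close>

text \<open>Indices outside \<open>roots\<close> only pad the matrix by an identity block, since \<open>det\<close> needs a
  type as index set.\<close>

definition root_form ::
    "(('k \<Rightarrow> 'n::finite mat_pair) \<Rightarrow> 'w \<Rightarrow> 'w) \<Rightarrow> 'k \<Rightarrow> (bool \<times> 'n \<times> 'n \<Rightarrow> 'w \<Rightarrow> complex) \<Rightarrow>
     'w \<Rightarrow> complex" where
  "root_form \<rho> l \<phi> v = det (\<chi> r r'. if r \<in> roots \<and> r' \<in> roots
     then root_deriv \<rho> l r' (\<phi> r) v else if r = r' then 1 else 0)"

lemma det_eq_0_if_kernel:
  fixes M :: "'a::field^'n^'n::finite"
  assumes "M *v c = 0" "c \<noteq> 0"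
  shows "det M = 0"
  using assms matrix_left_invertible_ker[of M] by (auto simp: invertible_det_nz[symmetric] invertible_def)

lemma det_curve:
  fixes X :: "complex \<Rightarrow> complex^'n^'n::finite"
  assumes "\<And>i j. \<exists>P. \<forall>x. X x $ i $ j = poly P x"
  shows "\<exists>P. \<forall>x. det (X x) = poly P x"
proof (rule polynomial_fun_curve[where q = det and c = X])
  show "polynomial_fun {\<lambda>X. X $ i $ j | i j. True} (det :: complex^'n^'n \<Rightarrow> complex)"
    by (rule polynomial_fun_det) (auto intro: polynomial_fun.coord)
qed (use assms in auto)

context tuple_rep
begin

lemma homogeneous_root_form:
  assumes "\<And>r. r \<in> roots \<Longrightarrow> functional (\<phi> r)"
  shows "homogeneous_form s (root_form \<rho> l \<phi>)"
  unfolding homogeneous_form_def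
proof
  show "polynomial_fun {\<phi>. functional \<phi>} (root_form \<rho> l \<phi>)"
    unfolding root_form_def
  proof (rule polynomial_fun_det)
    fix r r' :: "bool \<times> 'n \<times> 'n"
    show "polynomial_fun {\<phi>. functional \<phi>} (\<lambda>v. (\<chi> r r'. if r \<in> roots \<and> r' \<in> roots
        then root_deriv \<rho> l r' (\<phi> r) v else if r = r' then 1 else 0) $ r $ r')"
      by (cases "r \<in> roots \<and> r' \<in> roots")
        (auto intro: polynomial_fun.const polynomial_fun.coord functional_root_deriv assms)
  qed
  have "root_form \<rho> l \<phi> (s c v) = c ^ card (roots :: (bool \<times> 'n \<times> 'n) set) * root_form \<rho> l \<phi> v" for c v
  proof -
    \<comment> \<open>Only rows indexed by \<open>roots\<close> scale with the vector; the padding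
      rows are constant. Hence the degree is the number of roots.\<close>
    define d :: "bool \<times> 'n \<times> 'n \<Rightarrow> complex" where "d r = (if r \<in> roots then c else 1)" for r
    define M where "M r = (\<chi> r'. if r \<in> roots \<and> r' \<in> roots
      then root_deriv \<rho> l r' (\<phi> r) v else if r = r' then 1 else 0)" for r
    have scale: "root_deriv \<rho> l r' (\<phi> r) (s c v) = c * root_deriv \<rho> l r' (\<phi> r) v"
      if "r \<in> roots" "r' \<in> roots" for r r'
    proof -
      interpret D: Vector_Spaces.linear s "(*)" "root_deriv \<rho> l r' (\<phi> r)"
        using functional_root_deriv[OF assms] that by blast
      show ?thesis by (rule D.scale)
    qed
    have "root_form \<rho> l \<phi> (s c v) = det (\<chi> r. d r *s M r)"
      unfolding root_form_def
      by (rule arg_cong[of _ _ det]) (auto simp: vec_eq_iff d_def M_def scale)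
    also have "\<dots> = prod d UNIV * det (\<chi> r. M r)" by (rule det_rows_mul)
    also have "prod d UNIV = c ^ card (roots :: (bool \<times> 'n \<times> 'n) set)"
      by (simp add: d_def prod.If_cases)
    finally show ?thesis by (simp add: root_form_def M_def)
  qed
  then show "\<exists>d. \<forall>c v. root_form \<rho> l \<phi> (s c v) = c ^ d * root_form \<rho> l \<phi> v" by blast
qed

text \<open>The coefficients from \<open>root_relation\<close> form a nonzero kernel vector of the
  matrix. The identity block annihilates it too, since they vanish outside
  \<open>roots\<close>.\<close>

lemma root_form_orbit:
  assumes "CARD('n) \<ge> 2" "(UNIV \<rightarrow> trace_stab) \<subseteq> stabilizer \<rho> v"
    and "\<sigma> \<in> S" "det (fst (\<sigma> l)) \<noteq> 0" "det (snd (\<sigma> l)) \<noteq> 0"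
    and "\<And>r. r \<in> roots \<Longrightarrow> functional (\<phi> r)"
  shows "root_form \<rho> l \<phi> (\<rho> \<sigma> v) = 0"
proof -
  obtain c :: "complex^(bool \<times> 'n \<times> 'n)" where c: "c \<noteq> 0" "\<And>r. r \<notin> roots \<Longrightarrow> c $ r = 0"
      "\<And>\<phi>. functional \<phi> \<Longrightarrow> (\<Sum>r\<in>roots. c $ r * root_deriv \<rho> l r \<phi> (\<rho> \<sigma> v)) = 0"
    using root_relation[OF assms(1-5)] by blast
  have "(\<Sum>r'\<in>UNIV. (if r \<in> roots \<and> r' \<in> roots then root_deriv \<rho> l r' (\<phi> r) (\<rho> \<sigma> v)
      else if r = r' then 1 else 0) * c $ r') = 0" for r
  proof (cases "r \<in> roots")
    case True
    have "(\<Sum>r'\<in>UNIV. (if r \<in> roots \<and> r' \<in> roots then root_deriv \<rho> l r' (\<phi> r) (\<rho> \<sigma> v)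
        else if r = r' then 1 else 0) * c $ r') =
        (\<Sum>r'\<in>roots. c $ r' * root_deriv \<rho> l r' (\<phi> r) (\<rho> \<sigma> v))"
      by (rule sum.mono_neutral_cong_right) (use True c(2) in auto)
    then show ?thesis using c(3) assms(6) True by simp
  next
    case False
    then show ?thesis by (intro sum.neutral) (use c(2) in auto)
  qed
  then show ?thesis
    unfolding root_form_def
    by (intro det_eq_0_if_kernel[OF _ c(1)])
      (simp add: matrix_vector_mult_def vec_eq_iff)
qed

text \<open>Functionals dual, up to nonzero scalars, to the images of \<open>v\<close> under the
  root vectors make the matrix diagonal with nonzero entries.\<close>

lemma root_form_nonzero:
  assumes "stabilizer \<rho> v = (UNIV \<rightarrow> perm_stab)"
  shows "\<exists>\<phi>. (\<forall>r\<in>roots. functional (\<phi> r)) \<and> root_form \<rho> l \<phi> v \<noteq> 0"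
proof -
  obtain e :: "bool \<times> 'n \<Rightarrow> real" where e: "\<And>b. (\<Sum>i\<in>UNIV. e (b, i)) = 0" "inj_on (root_char e) roots"
    using regular_torus_elem_exists by blast
  have t: "at_place l (torus_elem e) \<in> UNIV \<rightarrow> perm_stab"
    by (rule torus_elem_in_perm_stab) (rule e(1))
  moreover have tSL: "at_place l (torus_elem e) \<in> UNIV \<rightarrow> SL_pair"
    using t by (auto simp: perm_stab_def SL_pair_iff case_prod_unfold Pi_iff)
  ultimately have fixed: "\<rho> (at_place l (torus_elem e)) v = v"
    using assms unfolding stabilizer_def by blast
  have "\<exists>\<phi>. functional \<phi> \<and> root_deriv \<rho> l r \<phi> v \<noteq> 0 \<and>
      (\<forall>r'\<in>roots - {r}. root_deriv \<rho> l r' \<phi> v = 0)" if r: "r \<in> roots" for r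
  proof -
    \<comment> \<open>The stabilizer is no larger than the power of \<open>perm_stab\<close>, so the
      root element moves \<open>v\<close>; hence some functional detects the root vector.\<close>
    have "\<rho> (at_place l (root_elem r 1)) v \<noteq> v"
      using root_elem_notin_perm_stab[OF r, of l, folded assms] root_elem_in_SL[OF r, of l 1]
      by (simp add: stabilizer_def)
    then obtain \<psi> where \<psi>: "functional \<psi>" "root_deriv \<rho> l r \<psi> v \<noteq> 0"
      using fixed_by_root_elem[OF r] by blast
    \<comment> \<open>Taking the characters of all other roots as unwanted weights kills every root
      except \<open>r\<close>, whose own character differs from them by regularity of
      \<open>e\<close>.\<close>
    obtain \<phi> where \<phi>: "functional \<phi>" "\<And>r'. r' \<in> roots \<Longrightarrow> root_deriv \<rho> l r' \<phi> v =
        (\<Prod>c\<in>root_char e ` (roots - {r}). root_char e r' - c) * root_deriv \<rho> l r' \<psi> v"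
      using weight_separation[OF fixed subsetD[OF SL_subset tSL] \<psi>(1),
          of "root_char e ` (roots - {r})"] by auto
    have "root_char e r \<notin> root_char e ` (roots - {r})"
      using e(2) r by (auto dest: inj_onD)
    then have "root_deriv \<rho> l r \<phi> v \<noteq> 0"
      using \<phi>(2)[OF r] \<psi>(2) by auto
    moreover have "root_deriv \<rho> l r' \<phi> v = 0" if "r' \<in> roots - {r}" for r'
      using \<phi>(2)[of r'] that by (auto intro!: prod_zero)
    ultimately show ?thesis using \<phi>(1) by blast
  qed
  then obtain \<phi> where \<phi>: "\<And>r. r \<in> roots \<Longrightarrow> functional (\<phi> r) \<and> root_deriv \<rho> l r (\<phi> r) v \<noteq> 0 \<and>
      (\<forall>r'\<in>roots - {r}. root_deriv \<rho> l r' (\<phi> r) v = 0)"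
    by metis
  have "root_form \<rho> l \<phi> v \<noteq> 0"
    unfolding root_form_def
    by (subst det_diagonal) (use \<phi> in auto)
  then show ?thesis using \<phi> by blast
qed

end

text \<open>Only place \<open>l\<close> must be nonsingular for \<open>root_form_orbit\<close>, so
  only that place is deformed: at parameter 0 the curve is \<sigma>, at parameter 1 place
  \<open>l\<close> holds the identity.\<close>

lemma root_form_image:
  fixes \<rho> :: "('k \<Rightarrow> 'n::finite mat_pair) \<Rightarrow> 'w::ab_group_add \<Rightarrow> 'w"
  assumes "tuple_rep s UNIV \<rho>"
    and "CARD('n) \<ge> 2" "(UNIV \<rightarrow> trace_stab) \<subseteq> stabilizer \<rho> v"
    and \<phi>: "\<And>r. r \<in> roots \<Longrightarrow> Vector_Spaces.linear s (*) (\<phi> r)"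
  shows "root_form \<rho> l \<phi> (\<rho> \<sigma> v) = 0"
proof -
  interpret tuple_rep s UNIV \<rho> by fact
  define Z where "Z X x = (\<chi> a b. (1 - x) * X $ a $ b + x * mat 1 $ a $ b)"
    for X :: "complex^'n^'n" and x
  define c where "c x = \<sigma>(l := (Z (fst (\<sigma> l)) x, Z (snd (\<sigma> l)) x))" for x
  have Z: "Z X 0 = X" "Z X 1 = mat 1" for X
    by (simp_all add: Z_def vec_eq_iff)
  have c: "c 0 = \<sigma>" by (simp add: c_def Z)
  have const: "\<exists>P. \<forall>x. a = poly P x" for a :: complex
    by (rule exI[of _ "[:a:]"]) simp
  have entry: "\<exists>P. \<forall>x. Z X x $ i $ j = poly P x" for X i j
    by (rule exI[of _ "[:X $ i $ j, mat 1 $ i $ j - X $ i $ j:]"]) (simp add: Z_def algebra_simps)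
  obtain P Q where P: "\<And>x. det (Z (fst (\<sigma> l)) x) = poly P x"
      and Q: "\<And>x. det (Z (snd (\<sigma> l)) x) = poly Q x"
    using det_curve[OF entry] by metis
  have "\<exists>P. \<forall>x. root_form \<rho> l \<phi> (\<rho> (c x) v) = poly P x"
  proof (rule polynomial_fun_curve[where c = "\<lambda>x. \<rho> (c x) v"])
    show "polynomial_fun {\<phi>. functional \<phi>} (root_form \<rho> l \<phi>)"
      using homogeneous_root_form[OF \<phi>] by (simp add: homogeneous_form_def)
    fix f assume "f \<in> {\<phi>. functional \<phi>}"
    moreover have "(\<exists>P. \<forall>x. fst (c x m) $ i $ j = poly P x) \<and>
        (\<exists>P. \<forall>x. snd (c x m) $ i $ j = poly P x)" for m i j
      by (cases "m = l") (simp_all add: c_def entry const)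
    ultimately show "\<exists>P. \<forall>x. f (\<rho> (c x) v) = poly P x"
      by (intro rep_curve) auto
  qed
  then obtain R where R: "\<And>x. root_form \<rho> l \<phi> (\<rho> (c x) v) = poly R x" by blast
  \<comment> \<open>Where \<open>P\<close> or \<open>Q\<close> vanishes the product is trivially
    zero; elsewhere both matrices at place \<open>l\<close> are invertible. As \<open>P\<close> and
    \<open>Q\<close> equal 1 at 1, the factor \<open>R\<close> must be the zero polynomial.\<close>
  have "poly (P * Q * R) x = 0" for x
  proof (cases "poly P x = 0 \<or> poly Q x = 0")
    case False
    then have "root_form \<rho> l \<phi> (\<rho> (c x) v) = 0"
      using assms P Q by (intro root_form_orbit) (auto simp: c_def)
    then show ?thesis by (simp add: R)
  qed auto
  then have "P * Q * R = 0" using poly_all_0_iff_0 by blast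
  moreover have "poly P 1 = 1" "poly Q 1 = 1" by (simp_all add: P[symmetric] Q[symmetric] Z)
  then have "P \<noteq> 0" "Q \<noteq> 0" by auto
  ultimately have "R = 0" by simp
  then show ?thesis using R[of 0] by (simp add: c)
qed

section \<open>Separation of the permanent from trace-like orbits\<close>

theorem theorem3p2p1:
  fixes s :: "complex \<Rightarrow> 'w::ab_group_add \<Rightarrow> 'w"
    and BasisW :: "'w set"
    and \<rho> :: "('k::finite \<Rightarrow> 'n::finite mat_pair) \<Rightarrow> 'w \<Rightarrow> 'w"
    and w h :: "'w set"
  assumes "CARD('n) \<ge> 2"
    and "finite_dimensional_vector_space s BasisW"
    and "polynomial_rep s (UNIV \<rightarrow> SL_pair) \<rho>"
    and "generalized_trace_like s \<rho> w"
    and "generalized_permanent s \<rho> h"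
  shows "(\<forall>\<rho>M. polynomial_extension s \<rho> \<rho>M \<longrightarrow>
            (\<forall>\<sigma>. \<forall>v \<in> w - {0}. \<rho>M \<sigma> v \<noteq> 0 \<longrightarrow> line s (\<rho>M \<sigma> v) \<noteq> h)) \<and>
         h \<notin> proj_closure s (orbit s \<rho> w)"
proof -
  interpret W: finite_dimensional_vector_space s BasisW by fact
  interpret SL: tuple_rep s "UNIV \<rightarrow> SL_pair" \<rho>
    by unfold_locales
      (use assms(3) in \<open>auto simp: SL_pair_iff tuple_mult_def Pi_iff det_mul\<close>)
  obtain vh where vh: "vh \<in> h" "stabilizer \<rho> vh = (UNIV \<rightarrow> perm_stab)" and h: "h \<in> proj_space s"
    using assms(5) by (auto simp: generalized_permanent_def)
  obtain vw where vw: "vw \<in> w - {0}" "(UNIV \<rightarrow> trace_stab) \<subseteq> stabilizer \<rho> vw"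
      and w: "w \<in> proj_space s"
    using assms(4) by (auto simp: generalized_trace_like_def)
  have trace: "(UNIV \<rightarrow> trace_stab) \<subseteq> stabilizer \<rho> v" if v: "v \<in> w" for v
  proof -
    obtain x where "w = range (\<lambda>c. s c x)"
      using w by (auto simp: proj_space_def line_def)
    then obtain a b where "vw = s a x" "v = s b x"
      using vw(1) v by blast
    moreover from this have "a \<noteq> 0" using vw(1) by auto
    ultimately have "v = s (b / a) vw" by simp
    then show ?thesis using vw(2) by (auto simp: stabilizer_def SL.rep_scale)
  qed
  \<comment> \<open>Any single place suffices, and one exists because the index type is
    inhabited.\<close>
  obtain l :: 'k where True by blast
  obtain \<phi> where \<phi>: "\<And>r. r \<in> roots \<Longrightarrow> SL.functional (\<phi> r)" and nz: "root_form \<rho> l \<phi> vh \<noteq> 0"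
    using SL.root_form_nonzero[OF vh(2)] by blast
  have hom: "homogeneous_form s (root_form \<rho> l \<phi>)"
    by (rule SL.homogeneous_root_form) (rule \<phi>)
  have on_line: "root_form \<rho> l \<phi> u = 0" if "root_form \<rho> l \<phi> v = 0" "u \<in> line s v" for u v
    using hom that by (auto simp: homogeneous_form_def line_def)
  have "line s (\<rho>M \<sigma> v) \<noteq> h" if ext: "polynomial_extension s \<rho> \<rho>M" and v: "v \<in> w" for \<rho>M \<sigma> v
  proof -
    have M: "tuple_rep s UNIV \<rho>M"
      by unfold_locales (use ext in \<open>auto simp: polynomial_extension_def\<close>)
    have eq: "\<rho>M g = \<rho> g" if "g \<in> UNIV \<rightarrow> SL_pair" for g
      using ext that by (simp add: polynomial_extension_def)
    then have "(UNIV \<rightarrow> trace_stab) \<subseteq> stabilizer \<rho>M v"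
      using trace[OF v] by (auto simp: stabilizer_def)
    then have "root_form \<rho>M l \<phi> (\<rho>M \<sigma> v) = 0"
      by (rule root_form_image[OF M assms(1) _ \<phi>])
    \<comment> \<open>The form uses the action of root elements only. These lie in
      \<open>SL_pair\<close> at every place, where the extension agrees with \<rho>.\<close>
    moreover have "root_form \<rho>M l \<phi> = root_form \<rho> l \<phi>"
      by (auto simp: fun_eq_iff root_form_def root_deriv_def eq root_elem_in_SL
          intro!: arg_cong[of _ _ det])
    ultimately show ?thesis using on_line vh(1) nz by auto
  qed
  moreover have "h \<notin> proj_closure s (orbit s \<rho> w)"
  proof
    \<comment> \<open>The hypersurface cut out by the form is a closed set that contains the orbit
      but not \<open>h\<close>.\<close>
    define Z where "Z = {L \<in> proj_space s. \<forall>f\<in>{root_form \<rho> l \<phi>}. \<forall>v\<in>L. f v = 0}"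
    assume "h \<in> proj_closure s (orbit s \<rho> w)"
    moreover have "proj_closed s Z"
      unfolding proj_closed_def Z_def using hom by (intro exI[of _ "{root_form \<rho> l \<phi>}"]) auto
    moreover have "orbit s \<rho> w \<subseteq> Z"
    proof
      fix L assume "L \<in> orbit s \<rho> w"
      then obtain g v where L: "L = line s (\<rho> g v)" and g: "g \<in> UNIV \<rightarrow> SL_pair"
          and v: "v \<in> w - {0}"
        by (auto simp: orbit_def)
      have det: "det (fst (g i)) = 1" "det (snd (g i)) = 1" for i
        using g by (auto simp: SL_pair_iff Pi_iff)
      have "root_form \<rho> l \<phi> (\<rho> g v) = 0"
        using assms(1) trace v g \<phi> by (intro SL.root_form_orbit) (auto simp: det)
      \<comment> \<open>This makes the line a point of projective space. An inverse of
        \<open>g\<close> is assembled place by place, and its determinants are 1 by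
        multiplicativity.\<close>
      moreover have "\<rho> g v \<noteq> 0"
      proof
        have "\<exists>m'. det (fst m') = 1 \<and> det (snd m') = 1 \<and> fst m' ** fst (g i) = mat 1 \<and> snd m' ** snd (g i) = mat 1" for i
        proof -
          have "invertible (fst (g i))" "invertible (snd (g i))"
            by (simp_all add: invertible_det_nz det)
          then obtain A B where AB: "A ** fst (g i) = mat 1" "B ** snd (g i) = mat 1"
            by (auto simp: invertible_def)
          have "det A = 1" "det B = 1"
            using arg_cong[OF AB(1), of det] arg_cong[OF AB(2), of det]
            by (simp_all add: det_mul det)
          then show ?thesis using AB by (intro exI[of _ "(A, B)"]) simp
        qed
        then obtain g' where g': "\<And>i. det (fst (g' i)) = 1 \<and> det (snd (g' i)) = 1 \<and>
            fst (g' i) ** fst (g i) = mat 1 \<and> snd (g' i) ** snd (g i) = mat 1"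
          by metis
        then have "tuple_mult g' g = tuple_one" "g' \<in> UNIV \<rightarrow> SL_pair"
          by (auto simp: tuple_mult_def tuple_one_def SL_pair_iff)
        then have "\<rho> g' (\<rho> g v) = v"
          using SL.rep_mult[of g' g v] g SL.rep_one by simp
        moreover assume "\<rho> g v = 0"
        moreover have "\<rho> g' 0 = 0"
          using SL.rep_scale[of g' 0 0] \<open>g' \<in> _\<close> by simp
        ultimately show False using v by simp
      qed
      ultimately show "L \<in> Z" using on_line by (auto simp: Z_def L proj_space_def)
    qed
    ultimately have "h \<in> Z" by (auto simp: proj_closure_def)
    then show False using vh(1) nz by (auto simp: Z_def)
  qed
  ultimately show ?thesis by blast
qed

end
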